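(* Let $(\mathbf{X}, d)$ be a proper geodesic space and let $\Omega\subsetneq\mathbf{X}$ be a bounded domain. If $u:\Omega\to\mathbb{R}$ is $\infty$-superharmonic in $\Omega$, then $|\nabla u|=|\nabla^-u|$ in $\Omega$, and this function is upper semicontinuous in $\Omega$. Symmetrically, if $u:\Omega\to\mathbb{R}$ is $\infty$-subharmonic in $\Omega$, then $|\nabla u|=|\nabla^+u|$ in $\Omega$, and this function is upper semicontinuous in $\Omega$.
   Context: A metric space $(\mathbf{X},d)$ is a geodesic space if any $x,y\in\mathbf{X}$ are joined by a Lipschitz curve of length $d(x,y)$; it is proper if all closed balls $\overline{B_r(x)}$ are compact. A domain is a nonempty connected open set. $\mathcal{O}\subset\subset\Omega$ means $\overline{\mathcal{O}}\subset\Omega$. $\infty$-superharmonic: a function $u:\Omega\to\mathbb{R}$ bounded from below is $\infty$-superharmonic in $\Omega$ if for any $\hat{x}\in\Omega$, $a\in\mathbb{R}$, $\kappa\le 0$ and any bounded open set $\mathcal{O}\subset\subset\Omega$ with $\hat{x}\in\Omega\setminus\mathcal{O}$, if $u\ge\phi$ on $\partial\mathcal{O}$, where $\phi=a+\kappa d(\hat{x},\cdot)$, then $u\ge\phi$ in $\overline{\mathcal{O}}$. A function $u$ bounded from above is $\infty$-subharmonic if $-u$ is $\infty$-superharmonic. (Both kinds of functions are automatically locally Lipschitz in $\Omega$.) Slopes: $|\nabla u|(x)=\limsup_{y\to x}\frac{|u(y)-u(x)|}{d(x,y)}$ and $|\nabla^\pm u|(x)=\limsup_{y\to x}\frac{[u(y)-u(x)]_\pm}{d(x,y)}$,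 where $[a]_\pm=\max\{\pm a,0\}$. *)

theory Defs
  imports "HOL-Analysis.Analysis"
begin

text \<open>
  Length of a curve parametrised on \<open>[0, 1]\<close>: the supremum of the lengths of the inscribed
  polygons, over all subdivisions \<open>0 = t 0 \<le> \<dots> \<le> t n = 1\<close>.
\<close>

definition curve_length :: "(real \<Rightarrow> 'a::metric_space) \<Rightarrow> ereal" where
  "curve_length \<gamma> =
     (SUP (n, t) \<in> {(n::nat, t::nat \<Rightarrow> real). mono_on {..n} t \<and> t 0 = 0 \<and> t n = 1}.
        ereal (\<Sum>i<n. dist (\<gamma> (t i)) (\<gamma> (t (Suc i)))))"

definition geodesic_space :: "'a::metric_space set \<Rightarrow> bool" where
  "geodesic_space X \<longleftrightarrow>
     (\<forall>x\<in>X. \<forall>y\<in>X. \<exists>\<gamma>. (\<exists>L. L-lipschitz_on {0..1} \<gamma>) \<and> path_image \<gamma> \<subseteq> X \<and>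
        pathstart \<gamma> = x \<and> pathfinish \<gamma> = y \<and> curve_length \<gamma> = ereal (dist x y))"

text \<open>
  A function \<open>\<Omega> \<rightarrow> \<real>\<close> is represented by a total function of which only the values on \<open>\<Omega>\<close>
  matter. Closure and frontier of \<open>U\<close> are those in the ambient space.
\<close>

definition infty_superharmonic_on :: "('a::metric_space \<Rightarrow> real) \<Rightarrow> 'a set \<Rightarrow> bool"
    (infix "infty'_superharmonic'_on" 50) where
  "u infty_superharmonic_on \<Omega> \<longleftrightarrow>
     bdd_below (u ` \<Omega>) \<and>
     (\<forall>z\<in>\<Omega>. \<forall>a \<kappa>. \<forall>U. \<kappa> \<le> 0 \<longrightarrow> open U \<longrightarrow> bounded U \<longrightarrow> closure U \<subseteq> \<Omega> \<longrightarrow> z \<in> \<Omega> - U \<longrightarrow>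
        (\<forall>x\<in>frontier U. u x \<ge> a + \<kappa> * dist z x) \<longrightarrow>
        (\<forall>x\<in>closure U. u x \<ge> a + \<kappa> * dist z x))"

definition infty_subharmonic_on :: "('a::metric_space \<Rightarrow> real) \<Rightarrow> 'a set \<Rightarrow> bool"
    (infix "infty'_subharmonic'_on" 50) where
  "u infty_subharmonic_on \<Omega> \<longleftrightarrow>
     bdd_above (u ` \<Omega>) \<and> (\<lambda>x. - u x) infty_superharmonic_on \<Omega>"

text \<open>
  The slopes are extended-real valued, since a priori the upper limits may be infinite. The
  limit is taken over \<open>y \<noteq> x\<close> in the domain \<open>\<Omega>\<close> of \<open>u\<close>.
\<close>

definition slope :: "'a::metric_space set \<Rightarrow> ('a \<Rightarrow> real) \<Rightarrow> 'a \<Rightarrow> ereal" where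
  "slope \<Omega> u x = Limsup (at x within \<Omega>) (\<lambda>y. ereal (\<bar>u y - u x\<bar> / dist x y))"

definition slope_plus :: "'a::metric_space set \<Rightarrow> ('a \<Rightarrow> real) \<Rightarrow> 'a \<Rightarrow> ereal" where
  "slope_plus \<Omega> u x = Limsup (at x within \<Omega>) (\<lambda>y. ereal (max (u y - u x) 0 / dist x y))"

definition slope_minus :: "'a::metric_space set \<Rightarrow> ('a \<Rightarrow> real) \<Rightarrow> 'a \<Rightarrow> ereal" where
  "slope_minus \<Omega> u x = Limsup (at x within \<Omega>) (\<lambda>y. ereal (max (- (u y - u x)) 0 / dist x y))"

definition upper_semicontinuous_on :: "'a::topological_space set \<Rightarrow> ('a \<Rightarrow> ereal) \<Rightarrow> bool" where
  "upper_semicontinuous_on S f \<longleftrightarrow>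
     (\<forall>x\<in>S. \<forall>c. f x < c \<longrightarrow> (\<forall>\<^sub>F y in at x within S. f y < c))"

end

theory Submission
  imports Defs
begin

text \<open>
  On a punctured ball \<open>ball x r - {x}\<close>, comparison with cones of vertex \<open>x\<close> says that a bound
  \<open>u \<ge> u x - \<kappa> r\<close> on the sphere propagates inwards to \<open>u \<ge> u x - \<kappa> dist x y\<close>
  (\<open>lower_cone_bound_in_ball\<close>). Thus the largest drop of \<open>u\<close> from \<open>x\<close> over a ball of radius
  \<open>r\<close>, divided by \<open>r\<close>, controls all difference quotients of \<open>u\<close> that go down from \<open>x\<close> within that
  ball, and the descending slope \<open>slope_minus\<close> is the limit of these normalised drops as
  \<open>r\<close> tends to \<open>0\<close>.

  The point is that the strict bound \<open>drop < c r\<close> is stable in the centre. For \<open>y\<close> close to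
  \<open>x\<close>, a slightly smaller ball about \<open>y\<close> lies in the ball about \<open>x\<close>, so \<open>u\<close> is no lower on it, and
  \<open>u y\<close> hardly exceeds \<open>u x\<close> because \<open>u\<close> is upper semicontinuous
  (\<open>superharmonic_upper_semicontinuous\<close>, itself an application of the cone bound). So if
  the descending slope at \<open>x\<close> is less than \<open>c\<close>, then \<open>u z \<ge> u y - c dist y z\<close> for \<open>y\<close> and \<open>z\<close>
  near \<open>x\<close>. Exchanging \<open>y\<close> and \<open>z\<close> turns this one-sided bound into a Lipschitz
  bound (\<open>superharmonic_lipschitz_near\<close>). Taking one of the points to be \<open>x\<close> bounds the full slope at
  \<open>x\<close>, and letting both vary bounds the full slope at all nearby points, which is upper
  semicontinuity. The subharmonic case follows by passing to \<open>- u\<close>.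
\<close>

section \<open>Consequences of comparison with cones\<close>

lemma lower_cone_bound_in_ball:
  fixes u :: "'a::metric_space \<Rightarrow> real"
  assumes sh: "u infty_superharmonic_on \<Omega>"
    and r: "r > 0" "cball x r \<subseteq> \<Omega>"
    and k: "\<kappa> \<ge> 0"
    and low: "\<And>y. dist x y = r \<Longrightarrow> u y \<ge> u x - \<kappa> * r"
    and y: "y \<in> cball x r"
  shows "u y \<ge> u x - \<kappa> * dist x y"
proof -
  define U where "U = ball x r - {x}"
  have op: "open U" unfolding U_def by (intro open_Diff) auto
  have bd: "bounded U" unfolding U_def by (meson Diff_subset bounded_ball bounded_subset)
  have cl: "closure U \<subseteq> cball x r" unfolding U_def
    by (intro closure_minimal) auto
  have fr: "w = x \<or> dist x w = r" if "w \<in> frontier U" for w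
  proof -
    from that have "w \<in> closure U" "w \<notin> U"
      using op by (auto simp: frontier_def interior_open)
    then show ?thesis using cl by (force simp: U_def)
  qed
  have bnd: "\<forall>w\<in>frontier U. u w \<ge> u x + (- \<kappa>) * dist x w"
    using fr low by fastforce
  have x: "x \<in> \<Omega> - U" using r by (auto simp: U_def)
  have in_U: "\<forall>w\<in>closure U. u w \<ge> u x + (- \<kappa>) * dist x w"
  proof -
    have "- \<kappa> \<le> 0" "closure U \<subseteq> \<Omega>" using k cl r by auto
    then show ?thesis
      using sh op bd x bnd unfolding infty_superharmonic_on_def by blast
  qed
  consider "y = x" | "dist x y = r" | "y \<in> U" using y by (force simp: U_def)
  then show ?thesis
  proof cases
    case 3
    then have "y \<in> closure U" using closure_subset by blast
    then show ?thesis using in_U by force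
  qed (use low in auto)
qed

text \<open>
  A global lower bound \<open>m\<close> of \<open>u\<close> already bounds the drop from any \<open>y\<close> near \<open>x\<close>. The resulting cone
  at \<open>y\<close>, evaluated at \<open>x\<close>, gives the Harnack-type inequality
  \<open>(u y - m) * (1 - dist x y / r) \<le> u x - m\<close>.
\<close>

lemma superharmonic_upper_semicontinuous:
  fixes u :: "'a::metric_space \<Rightarrow> real"
  assumes sh: "u infty_superharmonic_on \<Omega>" and op: "open \<Omega>" and x: "x \<in> \<Omega>" and e: "e > 0"
  shows "\<forall>\<^sub>F y in nhds x. u y < u x + e"
proof -
  have "bdd_below (u ` \<Omega>)" using sh unfolding infty_superharmonic_on_def by (rule conjunct1)
  then obtain m where m: "\<And>w. w \<in> \<Omega> \<Longrightarrow> m \<le> u w"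
    unfolding bdd_below_def by blast
  obtain R where R: "R > 0" "cball x R \<subseteq> \<Omega>" using op x open_contains_cball by blast
  define r where "r = R / 2"
  have r: "r > 0" using R by (simp add: r_def)
  have harnack: "u y \<le> m + (u x - m) / (1 - dist y x / r)" if y: "y \<in> ball x r" for y
  proof -
    have sub: "cball y r \<subseteq> \<Omega>"
    proof
      fix w assume "w \<in> cball y r"
      then have "dist x w \<le> R" using y dist_triangle[of x w y] by (auto simp: r_def)
      then show "w \<in> \<Omega>" using R by auto
    qed
    moreover have "y \<in> cball y r" using r by simp
    ultimately have "m \<le> u y" using m by blast
    moreover have "u w \<ge> u y - ((u y - m) / r) * r" if "dist y w = r" for w
      using m[of w] sub that r by auto
    ultimately have "u x \<ge> u y - ((u y - m) / r) * dist y x"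
      using lower_cone_bound_in_ball[OF sh r sub, of "(u y - m) / r" x] r y
      by (auto simp: dist_commute)
    then have "(u y - m) * (1 - dist y x / r) \<le> u x - m" by (simp add: algebra_simps)
    moreover have "1 - dist y x / r > 0" using y r by (simp add: dist_commute)
    ultimately have "u y - m \<le> (u x - m) / (1 - dist y x / r)" by (simp only: pos_le_divide_eq)
    then show ?thesis by simp
  qed
  have "((\<lambda>y. m + (u x - m) / (1 - dist y x / r)) \<longlongrightarrow> m + (u x - m) / (1 - dist x x / r)) (nhds x)"
    using r by (intro tendsto_intros filterlim_ident) auto
  then have "\<forall>\<^sub>F y in nhds x. m + (u x - m) / (1 - dist y x / r) < u x + e"
    using e by (intro order_tendstoD(2)) auto
  moreover have "\<forall>\<^sub>F y in nhds x. y \<in> ball x r"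
    using r by (intro eventually_nhds_in_open) auto
  ultimately show ?thesis
    by eventually_elim (use harnack in fastforce)
qed

text \<open>
  The room between the descending slope at \<open>x\<close> and \<open>c\<close> pays both for the change of \<open>u y\<close> and for
  the smaller radius when the cone bound is moved from centre \<open>x\<close> to a nearby centre \<open>y\<close>.
\<close>

lemma superharmonic_lipschitz_near:
  fixes u :: "'a::metric_space \<Rightarrow> real"
  assumes sh: "u infty_superharmonic_on \<Omega>" and op: "open \<Omega>" and x: "x \<in> \<Omega>"
    and c: "c > 0" and sl: "slope_minus \<Omega> u x < ereal c"
  shows "\<exists>\<delta>>0. ball x \<delta> \<subseteq> \<Omega> \<and> c-lipschitz_on (ball x \<delta>) u"
proof -
  have "max (slope_minus \<Omega> u x) 0 < ereal c" using sl c by simp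
  then obtain b where b: "slope_minus \<Omega> u x < ereal b" "0 < b" "b < c"
    using ereal_dense2 by (metis less_ereal.simps(1) max_less_iff_conj zero_ereal_def)
  have "\<forall>\<^sub>F y in at x within \<Omega>. ereal (max (- (u y - u x)) 0 / dist x y) < ereal b"
    using b(1) unfolding slope_minus_def by (rule Limsup_lessD)
  then obtain r0 where r0: "r0 > 0"
    "\<And>y. y \<in> \<Omega> \<Longrightarrow> y \<noteq> x \<Longrightarrow> dist y x < r0 \<Longrightarrow> max (- (u y - u x)) 0 / dist x y < b"
    by (auto simp: eventually_at)
  obtain R where R: "R > 0" "cball x R \<subseteq> \<Omega>" using op x open_contains_cball by blast
  define r where "r = min R (r0 / 2)"
  have r: "r > 0" "r < r0" "cball x r \<subseteq> \<Omega>" using R r0(1) by (auto simp: r_def)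
  have low: "u w \<ge> u x - b * r" if w: "w \<in> cball x r" for w
  proof (cases "w = x")
    case False
    have "w \<in> \<Omega>" "dist w x < r0" using w r by (auto simp: dist_commute)
    then have "max (- (u w - u x)) 0 / dist x w < b" using r0(2) False by blast
    then have "u x - u w \<le> b * dist x w" using False by (auto simp: field_simps)
    also have "\<dots> \<le> b * r" using w b by (intro mult_left_mono) auto
    finally show ?thesis by simp
  qed (use b r in auto)

  define \<epsilon> where "\<epsilon> = (c - b) * r / 2"
  have "\<epsilon> > 0" using b r by (simp add: \<epsilon>_def)
  from superharmonic_upper_semicontinuous[OF sh op x this]
  obtain d where d: "d > 0" "\<And>y. dist y x < d \<Longrightarrow> u y < u x + \<epsilon>"
    unfolding eventually_nhds_metric by blast
  define \<delta> where "\<delta> = Min {d, r / 3, \<epsilon> / c}"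
  have \<delta>: "\<delta> > 0" "\<delta> \<le> d" "\<delta> \<le> r / 3" "\<delta> \<le> \<epsilon> / c"
    unfolding \<delta>_def using d(1) r(1) c \<open>\<epsilon> > 0\<close> by (simp, (intro Min_le; simp)+)
  have cone: "u z \<ge> u y - c * dist y z" if y: "y \<in> ball x \<delta>" and z: "z \<in> ball x \<delta>" for y z
  proof -
    define s where "s = r - \<delta>"
    have sub: "cball y s \<subseteq> cball x r"
    proof
      fix w assume "w \<in> cball y s"
      then show "w \<in> cball x r" using y dist_triangle[of x w y] by (auto simp: s_def)
    qed
    have "c * \<delta> \<le> \<epsilon>" using \<delta>(4) c by (simp add: field_simps)
    \<comment> \<open>Half of the room \<open>(c - b) * r = 2 * \<epsilon>\<close> goes to the value at the centre, half to the radius.\<close>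
    then have room: "b * r + \<epsilon> \<le> c * s"
      unfolding s_def \<epsilon>_def by (simp add: field_simps)
    have "u w \<ge> u y - c * s" if "dist y w = s" for w
    proof -
      have "u w \<ge> u x - b * r" using low sub that by auto
      moreover have "u y < u x + \<epsilon>" using d(2)[of y] y \<delta> by (simp add: dist_commute)
      ultimately show ?thesis using room by linarith
    qed
    moreover have "z \<in> cball y s"
      using dist_triangle2[of y z x] y z \<delta>(3) by (simp add: s_def dist_commute)
    moreover have "s > 0" using \<delta> r by (simp add: s_def)
    ultimately show ?thesis
      using lower_cone_bound_in_ball[OF sh, of s y c z] sub r(3) c by auto
  qed
  have "c-lipschitz_on (ball x \<delta>) u"
  proof (rule lipschitz_onI)
    fix y z assume yz: "y \<in> ball x \<delta>" "z \<in> ball x \<delta>"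
    then show "dist (u y) (u z) \<le> c * dist y z"
      using cone[of y z] cone[of z y] by (simp add: dist_real_def dist_commute abs_le_iff)
  qed (use c in simp)
  moreover have "ball x \<delta> \<subseteq> \<Omega>" using r(3) \<delta> r(1) by auto
  ultimately show ?thesis using \<delta>(1) by blast
qed

section \<open>Slopes\<close>

lemma slope_le_lipschitz_constant:
  fixes u :: "'a::metric_space \<Rightarrow> real"
  assumes lip: "c-lipschitz_on B u" and "open B" "x \<in> B"
  shows "slope \<Omega> u x \<le> ereal c"
proof -
  have "\<forall>\<^sub>F y in at x within \<Omega>. y \<in> B"
    using assms(2,3) eventually_at_topological by blast
  then have "\<forall>\<^sub>F y in at x within \<Omega>. ereal (\<bar>u y - u x\<bar> / dist x y) \<le> ereal c"
  proof eventually_elim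
    case (elim y)
    have "\<bar>u y - u x\<bar> \<le> c * dist x y"
      using lipschitz_onD[OF lip elim \<open>x \<in> B\<close>] by (simp add: dist_real_def dist_commute)
    moreover have "c \<ge> 0" by (rule lipschitz_on_nonneg[OF lip])
    ultimately show ?case by (cases "x = y") (auto simp: field_simps)
  qed
  then show ?thesis unfolding slope_def by (rule Limsup_bounded)
qed

lemma slope_minus_le_slope: "slope_minus \<Omega> u x \<le> slope \<Omega> u x"
  unfolding slope_minus_def slope_def
  by (intro Limsup_mono always_eventually) (auto intro!: divide_right_mono)

lemma slope_minus_nonneg:
  assumes "at x within \<Omega> \<noteq> bot"
  shows "0 \<le> slope_minus \<Omega> u x"
  unfolding slope_minus_def
  using assms by (intro le_Limsup) auto

text \<open>
  At an isolated point of \<open>\<Omega>\<close> every slope is an upper limit along the trivial filter, hence \<open>-\<infinity>\<close>;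
  elsewhere the descending slope is nonnegative, so real bounds \<open>c\<close> above it are positive.
\<close>

lemma superharmonic_slope:
  fixes u :: "'a::metric_space \<Rightarrow> real"
  assumes sh: "u infty_superharmonic_on \<Omega>" and op: "open \<Omega>"
  shows superharmonic_slope_eq_slope_minus: "x \<in> \<Omega> \<Longrightarrow> slope \<Omega> u x = slope_minus \<Omega> u x"
    and superharmonic_slope_upper_semicontinuous: "upper_semicontinuous_on \<Omega> (slope \<Omega> u)"
proof -
  have near: "\<exists>\<delta>>0. \<forall>y\<in>ball x \<delta>. slope \<Omega> u y \<le> ereal c"
    if "x \<in> \<Omega>" "at x within \<Omega> \<noteq> bot" "slope_minus \<Omega> u x < ereal c" for x c
  proof -
    have "0 < ereal c" using slope_minus_nonneg[OF that(2)] that(3) by (rule le_less_trans)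
    then show ?thesis
      using superharmonic_lipschitz_near[OF sh op that(1) _ that(3)]
      by (metis ereal_less(2) open_ball slope_le_lipschitz_constant)
  qed
  show "slope \<Omega> u x = slope_minus \<Omega> u x" if x: "x \<in> \<Omega>" for x
  proof (cases "at x within \<Omega> = bot")
    case True
    then show ?thesis by (simp add: slope_def slope_minus_def Limsup_bot)
  next
    case False
    have "slope \<Omega> u x \<le> slope_minus \<Omega> u x"
    proof (rule ccontr)
      assume "\<not> ?thesis"
      then have "slope_minus \<Omega> u x < slope \<Omega> u x" by simp
      from ereal_dense2[OF this] obtain c
        where "slope_minus \<Omega> u x < ereal c" "ereal c < slope \<Omega> u x" by blast
      then show False using near[OF x False] by (meson centre_in_ball not_le)
    qed
    then show ?thesis using slope_minus_le_slope by (rule antisym)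
  qed
  show "upper_semicontinuous_on \<Omega> (slope \<Omega> u)"
    unfolding upper_semicontinuous_on_def
  proof (intro ballI allI impI)
    fix x c assume x: "x \<in> \<Omega>" and less: "slope \<Omega> u x < c"
    show "\<forall>\<^sub>F y in at x within \<Omega>. slope \<Omega> u y < c"
    proof (cases "at x within \<Omega> = bot")
      case False
      obtain c' where c': "slope \<Omega> u x < ereal c'" "ereal c' < c"
        using ereal_dense2[OF less] by blast
      then obtain \<delta> where "\<delta> > 0" "\<forall>y\<in>ball x \<delta>. slope \<Omega> u y \<le> ereal c'"
        using near[OF x False le_less_trans[OF slope_minus_le_slope c'(1)]] by blast
      then show ?thesis
        unfolding eventually_at using c'(2)
        by (intro exI[of _ \<delta>]) (auto simp: dist_commute intro: le_less_trans)
    qed simp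
  qed
qed

lemma slope_uminus: "slope \<Omega> (\<lambda>x. - u x) = slope \<Omega> u"
  unfolding slope_def by (simp add: fun_eq_iff abs_minus_commute)

lemma slope_minus_uminus: "slope_minus \<Omega> (\<lambda>x. - u x) = slope_plus \<Omega> u"
  unfolding slope_minus_def slope_plus_def by (simp add: fun_eq_iff)

theorem lemma2p5:
  fixes \<Omega> :: "'a::metric_space set" and u :: "'a \<Rightarrow> real"
  assumes proper: "\<And>(x::'a) r. compact (cball x r)"
    and geodesic: "geodesic_space (UNIV :: 'a set)"
    and domain: "open \<Omega>" "connected \<Omega>" "\<Omega> \<noteq> {}"
    and "bounded \<Omega>" and "\<Omega> \<subset> UNIV"
  shows "(u infty_superharmonic_on \<Omega> \<longrightarrow>
            (\<forall>x\<in>\<Omega>. slope \<Omega> u x = slope_minus \<Omega> u x) \<and>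
            upper_semicontinuous_on \<Omega> (slope \<Omega> u))
       \<and> (u infty_subharmonic_on \<Omega> \<longrightarrow>
            (\<forall>x\<in>\<Omega>. slope \<Omega> u x = slope_plus \<Omega> u x) \<and>
            upper_semicontinuous_on \<Omega> (slope \<Omega> u))"
proof (intro conjI impI)
  assume "u infty_superharmonic_on \<Omega>"
  note superharmonic_slope[OF this domain(1)]
  then show "\<forall>x\<in>\<Omega>. slope \<Omega> u x = slope_minus \<Omega> u x" "upper_semicontinuous_on \<Omega> (slope \<Omega> u)"
    by blast+
next
  assume "u infty_subharmonic_on \<Omega>"
  then have "(\<lambda>x. - u x) infty_superharmonic_on \<Omega>"
    by (simp add: infty_subharmonic_on_def)
  note superharmonic_slope[OF this domain(1), unfolded slope_uminus slope_minus_uminus]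
  then show "\<forall>x\<in>\<Omega>. slope \<Omega> u x = slope_plus \<Omega> u x" "upper_semicontinuous_on \<Omega> (slope \<Omega> u)"
    by blast+
qed

end
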